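(* Let $n\ge3$ and let $\mathbf{P}$ be a harmonic $n$-gon inscribed in the unit circle. Then the hyperbolic barycenter $S_{\mathbf{P}}$ of $\mathbf{P}$ coincides with the least-squares point $L_{\mathbf{P}}$ of $\mathbf{P}$: $S_{\mathbf{P}}=L_{\mathbf{P}}$.
   Context: The unit circle $\mathbf{O}$ is identified with $\mathbb{RP}^1=\mathbb{R}\cup\{\infty\}$ by $p\mapsto P=\left(\frac{1-p^2}{1+p^2},\frac{2p}{1+p^2}\right)$, $\infty\mapsto(-1,0)$; the open unit disc is the Klein–Beltrami model of the hyperbolic plane, in which geodesics are open chords. A polygon $\mathbf{P}=(p_1,\dots,p_n)$ inscribed in $\mathbf{O}$, with vertices the points $P_\ell$ corresponding to pairwise distinct $p_\ell$, and sides $\xi_\ell=P_\ell P_{\ell+1}$ (indices modulo $n$), is regarded both as a Euclidean polygon and as an ideal hyperbolic polygon. It is harmonic if it is the image of a (convex) regular $n$-gon inscribed in $\mathbf{O}$ under an isometry of the hyperbolic plane (equivalently, under a projective transformation preserving $\mathbf{O}$). The hyperbolic barycenter is $$S_{\mathbf{P}}=\left(\frac{I-K}{I+K},\frac{2J}{I+K}\right),\quad I=\sum_{\ell}\frac{1}{p_\ell-p_{\ell+1}},\ J=\frac12\sum_{\ell}\frac{p_\ell+p_{\ell+1}}{p_\ell-p_{\ell+1}},\ K=\sum_{\ell}\frac{p_\ell p_{\ell+1}}{p_\ell-p_{\ell+1}},$$ where, if one of the $p_\ell$ is $\infty$, each summand is replaced by its limit (one has $I+K\neq0$ whenever $\mathbf{P}$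 is convex, in particular when it is harmonic). The least-squares point $L_{\mathbf{P}}$ is the unique point of the Euclidean plane minimizing $\sum_\ell d_\ell(X)^2$, where $d_\ell(X)$ is the Euclidean distance from $X$ to the line through $P_\ell$ and $P_{\ell+1}$. *)

theory Defs
  imports "HOL-Analysis.Analysis"
begin

text \<open>The projective line is \<^typ>\<open>real option\<close>, with \<^term>\<open>None\<close> as the point at infinity
  (as in the library's one-point compactification). The Euclidean plane is
  \<^typ>\<open>real \<times> real\<close>, whose library norm, metric and inner product are the Euclidean ones.\<close>

type_synonym rp1 = "real option"
type_synonym plane = "real \<times> real"

fun circle_point :: "rp1 \<Rightarrow> plane" where
  "circle_point (Some p) = ((1 - p\<^sup>2) / (1 + p\<^sup>2), 2 * p / (1 + p\<^sup>2))"
| "circle_point None = (-1, 0)"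

text \<open>A polygon with \<open>n\<close> vertices is a function \<open>p :: nat \<Rightarrow> rp1\<close> of which only the values at
  \<open>0, \<dots>, n - 1\<close> matter; the successor of the index \<open>l\<close> is \<open>Suc l mod n\<close>.\<close>

definition inscribed_polygon :: "nat \<Rightarrow> (nat \<Rightarrow> rp1) \<Rightarrow> bool" where
  "inscribed_polygon n p \<longleftrightarrow> inj_on p {..<n}"

text \<open>Distance of the Klein--Beltrami model (curvature \<open>-1\<close>), meaningful on the open unit disc.\<close>

definition klein_dist :: "plane \<Rightarrow> plane \<Rightarrow> real" where
  "klein_dist x y =
     arcosh ((1 - x \<bullet> y) / sqrt ((1 - (norm x)\<^sup>2) * (1 - (norm y)\<^sup>2)))"

definition klein_isometry :: "(plane \<Rightarrow> plane) \<Rightarrow> bool" where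
  "klein_isometry f \<longleftrightarrow>
     bij_betw f (ball 0 1) (ball 0 1) \<and>
     (\<forall>x\<in>ball 0 1. \<forall>y\<in>ball 0 1. klein_dist (f x) (f y) = klein_dist x y)"

text \<open>Convex regular \<open>n\<close>-gons inscribed in the unit circle, starting at any point and traversed in
  either direction.\<close>

definition regular_polygon :: "nat \<Rightarrow> (nat \<Rightarrow> plane) \<Rightarrow> bool" where
  "regular_polygon n R \<longleftrightarrow>
     (\<exists>\<theta> \<epsilon>. \<epsilon> \<in> {1, -1 :: real} \<and>
        (\<forall>l<n. R l = (cos (\<theta> + \<epsilon> * (2 * pi * real l / real n)),
                       sin (\<theta> + \<epsilon> * (2 * pi * real l / real n)))))"

text \<open>An isometry of the open disc acts on ideal points through its continuous extension to the
  boundary circle, hence the limit.\<close>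

definition harmonic_polygon :: "nat \<Rightarrow> (nat \<Rightarrow> rp1) \<Rightarrow> bool" where
  "harmonic_polygon n p \<longleftrightarrow>
     (\<exists>f R. klein_isometry f \<and> regular_polygon n R \<and>
        (\<forall>l<n. (f \<longlongrightarrow> circle_point (p l)) (at (R l) within ball 0 1)))"

text \<open>Extends a summand \<open>g\<close> to arguments one of which is the point at infinity, by taking the
  limit; \<^term>\<open>at_infinity\<close> is the filter \<open>\<bar>t\<bar> \<rightarrow> \<infinity>\<close>. The last case does not occur for
  distinct vertices.\<close>

fun side_term :: "(real \<Rightarrow> real \<Rightarrow> real) \<Rightarrow> rp1 \<Rightarrow> rp1 \<Rightarrow> real" where
  "side_term g (Some a) (Some b) = g a b"
| "side_term g None (Some b) = Lim at_infinity (\<lambda>t. g t b)"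
| "side_term g (Some a) None = Lim at_infinity (\<lambda>t. g a t)"
| "side_term g None None = 0"

definition I_sum :: "nat \<Rightarrow> (nat \<Rightarrow> rp1) \<Rightarrow> real" where
  "I_sum n p = (\<Sum>l<n. side_term (\<lambda>a b. 1 / (a - b)) (p l) (p (Suc l mod n)))"

definition J_sum :: "nat \<Rightarrow> (nat \<Rightarrow> rp1) \<Rightarrow> real" where
  "J_sum n p = 1 / 2 * (\<Sum>l<n. side_term (\<lambda>a b. (a + b) / (a - b)) (p l) (p (Suc l mod n)))"

definition K_sum :: "nat \<Rightarrow> (nat \<Rightarrow> rp1) \<Rightarrow> real" where
  "K_sum n p = (\<Sum>l<n. side_term (\<lambda>a b. a * b / (a - b)) (p l) (p (Suc l mod n)))"

definition hyperbolic_barycenter :: "nat \<Rightarrow> (nat \<Rightarrow> rp1) \<Rightarrow> plane" where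
  "hyperbolic_barycenter n p =
     ((I_sum n p - K_sum n p) / (I_sum n p + K_sum n p),
      2 * J_sum n p / (I_sum n p + K_sum n p))"

definition side_line :: "nat \<Rightarrow> (nat \<Rightarrow> rp1) \<Rightarrow> nat \<Rightarrow> plane set" where
  "side_line n p l = affine hull {circle_point (p l), circle_point (p (Suc l mod n))}"

definition sum_sq_dist :: "nat \<Rightarrow> (nat \<Rightarrow> rp1) \<Rightarrow> plane \<Rightarrow> real" where
  "sum_sq_dist n p X = (\<Sum>l<n. (infdist X (side_line n p l))\<^sup>2)"

definition least_squares_point :: "nat \<Rightarrow> (nat \<Rightarrow> rp1) \<Rightarrow> plane" where
  "least_squares_point n p = (THE X. \<forall>Y. sum_sq_dist n p X \<le> sum_sq_dist n p Y)"

end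

theory Submission
  imports Defs
begin

text \<open>
  Lift a point \<open>X\<close> of the plane to \<open>(1, X)\<close> in Minkowski space of signature \<open>(+, -, -)\<close>. Points of the
  circle become null vectors, and the Minkowski product of two lifts is the gap \<open>1 - A \<bullet> B\<close>. A chord
  \<open>AB\<close> has a pole: the vector orthogonal to both lifts, of Minkowski square \<open>-1\<close>, with sign fixed by
  the direction of the chord. The proof rests on four observations.

  First, the coordinates of the poles of the sides, added up, are exactly \<open>I + K\<close>, \<open>I - K\<close> and \<open>2J\<close>;
  so \<open>S\<close> is the sum \<open>T\<close> of the poles, projected back to the plane
  (\<open>hyperbolic_barycenter_eq_pole_sum\<close>).

  Second, the product of two poles is a combination of cross ratios of gaps (\<open>mink_pole_pole\<close>). An
  isometry of the Klein model multiplies the gap of \<open>x\<close> and \<open>y\<close> by a factor \<open>\<mu> x * \<mu> y\<close>; the factors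
  cancel in cross ratios, which therefore survive the passage to the boundary
  (\<open>klein_isometry_gap_cross_ratio\<close>). In this way the classification of isometries is avoided.

  Third, the products of poles of a harmonic polygon are consequently those of a regular one. There, by
  symmetry, the product of the \<open>l\<close>-th pole with \<open>T\<close> is the same for every \<open>l\<close>, and a trigonometric
  sum evaluates it to \<open>n * cot\<^sup>2 (pi / n) > 0\<close> (\<open>harmonic_mink_pole_sum\<close>). Positivity makes \<open>T\<close>
  timelike, hence \<open>I + K \<noteq> 0\<close>.

  Fourth, the signed distance of \<open>X\<close> to the line of a side is the product of \<open>(1, X)\<close> with the pole,
  times half the length of the side. So the signed distances of \<open>S\<close> to the side lines are
  proportional to the side lengths. The gradient at \<open>S\<close> of the sum of squared distances is then a
  multiple of the sum of the sides turned by a right angle, which vanishes because the polygon closes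
  up. The sum of squares is a quadratic function, strictly convex because a triangle inscribed in a
  circle has sides that are not all parallel; so \<open>S\<close> is its only minimum (\<open>least_squares_point_eqI\<close>).
\<close>

section \<open>Gaps between points and their behaviour under isometries\<close>

definition gap :: "plane \<Rightarrow> plane \<Rightarrow> real" where
  "gap A B = 1 - A \<bullet> B"

lemma gap_commute: "gap A B = gap B A"
  by (simp add: gap_def inner_commute)

lemma gap_unit:
  assumes "norm A = 1" "norm B = 1"
  shows "(norm (B - A))\<^sup>2 = 2 * gap A B"
  using assms
  by (simp add: gap_def power2_norm_eq_inner inner_diff_left inner_diff_right
      inner_commute norm_eq_1)

lemma gap_unit_pos:
  assumes "norm A = 1" "norm B = 1" "A \<noteq> B"
  shows "gap A B > 0"
proof -
  have "(norm (B - A))\<^sup>2 > 0" using assms(3) by simp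
  then show ?thesis using gap_unit[OF assms(1,2)] by simp
qed

text \<open>The reverse Cauchy-Schwarz inequality for timelike vectors. It places the argument of \<^const>\<open>arcosh\<close> in
  \<^const>\<open>klein_dist\<close> in the range where \<^const>\<open>arcosh\<close> is injective.\<close>

lemma gap_ball_reverse_Cauchy_Schwarz:
  assumes "norm x < 1" "norm y < 1"
  shows "sqrt ((1 - (norm x)\<^sup>2) * (1 - (norm y)\<^sup>2)) \<le> gap x y"
proof (rule real_le_lsqrt)
  have le: "1 - norm x * norm y \<le> gap x y"
    using Cauchy_Schwarz_ineq2[of x y] by (simp add: gap_def)
  have "norm x * norm y \<le> 1"
    using assms mult_le_one[of "norm x" "norm y"] by simp
  then have nn: "0 \<le> 1 - norm x * norm y" by simp
  then show "0 \<le> gap x y" using le by linarith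
  have "(1 - (norm x)\<^sup>2) * (1 - (norm y)\<^sup>2) + (norm x - norm y)\<^sup>2 = (1 - norm x * norm y)\<^sup>2"
    by (simp add: power2_eq_square algebra_simps)
  then have "(1 - (norm x)\<^sup>2) * (1 - (norm y)\<^sup>2) \<le> (1 - norm x * norm y)\<^sup>2"
    by (smt (verit) zero_le_power2)
  also have "\<dots> \<le> (gap x y)\<^sup>2"
    using le nn by (rule power_mono)
  finally show "(1 - (norm x)\<^sup>2) * (1 - (norm y)\<^sup>2) \<le> (gap x y)\<^sup>2" .
qed

text \<open>Isometries preserve gaps up to normalization: the quotient of the gap by the Minkowski lengths of
  the two lifts is the hyperbolic cosine of the distance.\<close>

lemma klein_isometry_rescales_gap:
  assumes "klein_isometry f"
  shows "\<exists>\<mu>. \<forall>x y. norm x < 1 \<longrightarrow> norm y < 1 \<longrightarrow> gap (f x) (f y) = \<mu> x * \<mu> y * gap x y"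
proof (intro exI allI impI)
  define h :: "plane \<Rightarrow> real" where "h x = sqrt (1 - (norm x)\<^sup>2)" for x
  fix x y :: plane
  assume x: "norm x < 1" and y: "norm y < 1"
  have f: "norm (f x) < 1" "norm (f y) < 1"
    using assms x y by (auto simp: klein_isometry_def bij_betw_def)
  have h: "h z > 0" if "norm z < 1" for z
    using that by (simp add: h_def power_less_one_iff abs_square_less_1)
  have ge1: "gap u v / (h u * h v) \<ge> 1" if "norm u < 1" "norm v < 1" for u v
    using gap_ball_reverse_Cauchy_Schwarz[OF that] h[OF that(1)] h[OF that(2)]
    by (simp add: h_def real_sqrt_mult)
  have dist: "klein_dist u v = arcosh (gap u v / (h u * h v))" for u v
    by (simp add: klein_dist_def gap_def h_def real_sqrt_mult)
  have "klein_dist (f x) (f y) = klein_dist x y"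
    using assms x y by (simp add: klein_isometry_def)
  then have "gap (f x) (f y) / (h (f x) * h (f y)) = gap x y / (h x * h y)"
    unfolding dist using ge1[OF f] ge1[OF x y] by (metis cosh_arcosh_real)
  then show "gap (f x) (f y) = (h (f x) / h x) * (h (f y) / h y) * gap x y"
    using h[OF x] h[OF y] h[OF f(1)] h[OF f(2)] by (simp add: field_simps)
qed

text \<open>Inside the disc, \<open>klein_isometry_rescales_gap\<close> produces the same factor \<open>\<mu> a * \<mu> b * \<mu> c * \<mu> d\<close> on both
  sides. The resulting equation between gaps no longer mentions \<open>\<mu>\<close>, so it extends to ideal points by
  continuity. It is cleared of denominators because gaps vanish when ideal points coincide.\<close>

lemma klein_isometry_gap_cross_ratio:
  assumes f: "klein_isometry f"
    and unit: "\<And>i. i \<in> {a, b, c, d} \<Longrightarrow> norm (R i) = 1"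
    and lim: "\<And>i. i \<in> {a, b, c, d} \<Longrightarrow> (f \<longlongrightarrow> P i) (at (R i) within ball 0 1)"
  shows "gap (P a) (P b) * gap (P c) (P d) * (gap (R a) (R c) * gap (R b) (R d))
       = gap (R a) (R b) * gap (R c) (R d) * (gap (P a) (P c) * gap (P b) (P d))"
proof -
  obtain \<mu> where \<mu>: "\<And>x y. norm x < 1 \<Longrightarrow> norm y < 1 \<Longrightarrow> gap (f x) (f y) = \<mu> x * \<mu> y * gap x y"
    using klein_isometry_rescales_gap[OF f] by blast
  \<comment> \<open>Radial approach to all four ideal points at the same speed.\<close>
  define x where "x i k = (1 - inverse (real (Suc k))) *\<^sub>R R i" for i k
  have norm_x: "norm (x i k) < 1" if "i \<in> {a, b, c, d}" for i k
    using unit[OF that] by (simp add: x_def abs_less_iff field_simps)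
  have x: "x i \<longlonglongrightarrow> R i" for i
  proof -
    have "(\<lambda>k. (1 - inverse (real (Suc k))) *\<^sub>R R i) \<longlonglongrightarrow> (1 - 0) *\<^sub>R R i"
      by (intro tendsto_intros LIMSEQ_inverse_real_of_nat)
    then show ?thesis by (simp add: x_def[abs_def])
  qed
  have fx: "(\<lambda>k. f (x i k)) \<longlonglongrightarrow> P i" if i: "i \<in> {a, b, c, d}" for i
  proof (rule filterlim_compose[OF lim[OF i]])
    have "x i k \<noteq> R i" for k
      using norm_x[OF i, of k] unit[OF i] by auto
    then show "filterlim (x i) (at (R i) within ball 0 1) sequentially"
      using x[of i] norm_x[OF i] by (auto simp: filterlim_at)
  qed
  have gap_lim: "(\<lambda>k. gap (u k) (v k)) \<longlonglongrightarrow> gap U V"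
    if "u \<longlonglongrightarrow> U" "v \<longlonglongrightarrow> V" for u v U V
    unfolding gap_def using that by (intro tendsto_intros)
  let ?L = "\<lambda>k. gap (f (x a k)) (f (x b k)) * gap (f (x c k)) (f (x d k))
      * (gap (x a k) (x c k) * gap (x b k) (x d k))"
  let ?R = "\<lambda>k. gap (x a k) (x b k) * gap (x c k) (x d k)
      * (gap (f (x a k)) (f (x c k)) * gap (f (x b k)) (f (x d k)))"
  have "?L k = ?R k" for k
    by (simp add: \<mu> norm_x)
  moreover have "?L \<longlonglongrightarrow> gap (P a) (P b) * gap (P c) (P d) * (gap (R a) (R c) * gap (R b) (R d))"
    by (intro tendsto_mult gap_lim x fx) auto
  moreover have "?R \<longlonglongrightarrow> gap (R a) (R b) * gap (R c) (R d) * (gap (P a) (P c) * gap (P b) (P d))"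
    by (intro tendsto_mult gap_lim x fx) auto
  ultimately show ?thesis
    using LIMSEQ_unique by (metis (no_types, lifting) LIMSEQ_unique ext)
qed

section \<open>Poles of chords in Minkowski space\<close>

definition mink :: "real \<times> plane \<Rightarrow> real \<times> plane \<Rightarrow> real" where
  "mink u v = fst u * fst v - snd u \<bullet> snd v"

lemma mink_sum_right: "mink u (\<Sum>i\<in>A. v i) = (\<Sum>i\<in>A. mink u (v i))"
  by (simp add: mink_def fst_sum snd_sum sum_subtractf sum_distrib_left inner_sum_right)

lemma mink_sum_left: "mink (\<Sum>i\<in>A. v i) u = (\<Sum>i\<in>A. mink (v i) u)"
  by (simp add: mink_def fst_sum snd_sum sum_subtractf sum_distrib_right inner_sum_left)

text \<open>The Minkowski cross product of the lifts \<open>(1, A)\<close> and \<open>(1, B)\<close>, up to sign. Its spatial part is the side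
  \<open>B - A\<close> turned by a right angle, and \<open>mink (chord_normal A B) (1, X) = 0\<close> is the equation of the line
  \<open>AB\<close>. Dividing by the gap makes the result independent of the scaling of the null vectors.\<close>

definition chord_normal :: "plane \<Rightarrow> plane \<Rightarrow> real \<times> plane" where
  "chord_normal A B = (snd A * fst B - fst A * snd B, (snd A - snd B, fst B - fst A))"

definition pole :: "plane \<Rightarrow> plane \<Rightarrow> real \<times> plane" where
  "pole A B = (1 / gap A B) *\<^sub>R chord_normal A B"

text \<open>Lagrange's identity for the cross product. Each index occurs equally often in numerator and
  denominator, so only cross ratios of gaps enter.\<close>

lemma mink_pole_pole:
  "mink (pole A B) (pole C D) =
     (gap A C * gap B D - gap A D * gap B C) / (gap A B * gap C D)"
proof -
  have "mink (chord_normal A B) (chord_normal C D) = gap A C * gap B D - gap A D * gap B C"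
    by (simp add: mink_def chord_normal_def gap_def inner_prod_def algebra_simps)
  moreover have "mink (r *\<^sub>R u) (s *\<^sub>R v) = r * s * mink u v" for r s u v
    by (simp add: mink_def algebra_simps)
  ultimately show ?thesis
    by (simp add: pole_def)
qed

section \<open>The barycenter as a sum of poles\<close>

lemma norm_circle_point [simp]: "norm (circle_point x) = 1"
proof (cases x)
  case (Some p)
  have "1 + p\<^sup>2 > 0" by (simp add: add_pos_nonneg)
  then have "((1 - p\<^sup>2) / (1 + p\<^sup>2))\<^sup>2 + (2 * p / (1 + p\<^sup>2))\<^sup>2 = 1"
    by (simp add: power_divide add_divide_distrib[symmetric] divide_eq_eq)
       (simp add: power2_eq_square algebra_simps)
  then show ?thesis by (simp add: Some norm_eq_1 power2_eq_square)
qed (simp add: norm_Pair)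

text \<open>The parametrization is stereographic projection from \<open>(-1, 0)\<close>: the parameter is recovered as the slope
  \<open>snd P / (1 + fst P)\<close>, whose denominator vanishes only at that point.\<close>

lemma circle_point_eq_iff: "circle_point x = circle_point y \<longleftrightarrow> x = y"
proof -
  have pos: "1 + p\<^sup>2 > 0" for p :: real by (simp add: add_pos_nonneg)
  have fst: "1 + fst (circle_point (Some p)) = 2 / (1 + p\<^sup>2)" for p
    using pos[of p] by (simp add: field_simps)
  have snd: "snd (circle_point (Some p)) = p * (1 + fst (circle_point (Some p)))" for p
    by (simp only: fst) simp
  have ne: "1 + fst (circle_point (Some p)) \<noteq> 0" for p
    using pos[of p] by (simp only: fst) simp
  have "fst (circle_point None) = -1" by simp
  then show ?thesis
    using snd ne by (cases x; cases y) (metis add.right_inverse mult_right_cancel)+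
qed

lemma side_terms_at_infinity:
  fixes b :: real
  shows "Lim at_infinity (\<lambda>t. 1 / (t - b)) = 0"
    and "Lim at_infinity (\<lambda>t. 1 / (b - t)) = 0"
    and "Lim at_infinity (\<lambda>t. (t + b) / (t - b)) = 1"
    and "Lim at_infinity (\<lambda>t. (b + t) / (b - t)) = -1"
    and "Lim at_infinity (\<lambda>t. t * b / (t - b)) = b"
    and "Lim at_infinity (\<lambda>t. b * t / (b - t)) = - b"
proof -
  have nontriv: "at_infinity \<noteq> (bot :: real filter)" by (rule trivial_limit_at_infinity)
  have "filterlim (\<lambda>t::real. - b + t) at_infinity at_infinity"
    by (rule tendsto_add_filterlim_at_infinity[OF tendsto_const filterlim_ident])
  then have 0: "((\<lambda>t. inverse (t - b)) \<longlongrightarrow> 0) at_infinity"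
    using filterlim_compose[OF tendsto_inverse_0] by fastforce
  have ev: "eventually (\<lambda>t. t \<noteq> b) at_infinity"
    by (rule eventually_not_equal_at_infinity)
  \<comment> \<open>All the functions are of this form, by partial fractions.\<close>
  have lim: "Lim at_infinity g = \<alpha> + \<gamma> * 0"
    if "\<And>t. t \<noteq> b \<Longrightarrow> g t = \<alpha> + \<gamma> * inverse (t - b)" for g \<alpha> \<gamma>
  proof (rule tendsto_Lim[OF nontriv])
    have "((\<lambda>t. \<alpha> + \<gamma> * inverse (t - b)) \<longlongrightarrow> \<alpha> + \<gamma> * 0) at_infinity"
      by (intro tendsto_intros 0)
    then show "(g \<longlongrightarrow> \<alpha> + \<gamma> * 0) at_infinity"
      by (rule Lim_transform_eventually) (use ev that in \<open>auto elim: eventually_mono\<close>)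
  qed
  show "Lim at_infinity (\<lambda>t. 1 / (t - b)) = 0"
    using lim[of "\<lambda>t. 1 / (t - b)" 0 1] by (simp add: field_simps)
  show "Lim at_infinity (\<lambda>t. 1 / (b - t)) = 0"
    using lim[of "\<lambda>t. 1 / (b - t)" 0 "-1"] by (simp add: field_simps)
  show "Lim at_infinity (\<lambda>t. (t + b) / (t - b)) = 1"
    using lim[of "\<lambda>t. (t + b) / (t - b)" 1 "2 * b"] by (simp add: field_simps)
  show "Lim at_infinity (\<lambda>t. (b + t) / (b - t)) = -1"
    using lim[of "\<lambda>t. (b + t) / (b - t)" "-1" "- 2 * b"] by (simp add: field_simps)
  show "Lim at_infinity (\<lambda>t. t * b / (t - b)) = b"
    using lim[of "\<lambda>t. t * b / (t - b)" b "b * b"] by (simp add: field_simps)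
  show "Lim at_infinity (\<lambda>t. b * t / (b - t)) = - b"
    using lim[of "\<lambda>t. b * t / (b - t)" "- b" "- b * b"] by (simp add: field_simps)
qed

text \<open>For finite parameters \<open>a\<close> and \<open>b\<close> the pole is \<open>(1 + a * b, (1 - a * b, a + b)) / (a - b)\<close>; this also explains
  why the limits at infinity are the right convention, the pole being continuous in its endpoints.\<close>

lemma pole_circle_points:
  assumes "x \<noteq> y"
  defines "i \<equiv> side_term (\<lambda>a b. 1 / (a - b)) x y"
    and "j \<equiv> side_term (\<lambda>a b. (a + b) / (a - b)) x y"
    and "k \<equiv> side_term (\<lambda>a b. a * b / (a - b)) x y"
  shows "pole (circle_point x) (circle_point y) = (i + k, (i - k, j))"
proof -
  have pos: "1 + p\<^sup>2 > 0" for p :: real by (simp add: add_pos_nonneg)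
  consider (fin) p q where "x = Some p" "y = Some q" "p \<noteq> q"
    | (infl) q where "x = None" "y = Some q" | (infr) p where "x = Some p" "y = None"
    using assms(1) by (cases x; cases y) auto
  then show ?thesis
  proof cases
    case fin
    let ?d = "(1 + p\<^sup>2) * (1 + q\<^sup>2)"
    have d: "?d > 0" using pos by simp
    have g: "gap (circle_point x) (circle_point y) = 2 * (p - q)\<^sup>2 / ?d"
      using pos[of p] pos[of q] unfolding fin gap_def
      by (simp add: inner_prod_def divide_simps) (simp add: power2_eq_square algebra_simps)
    have c: "chord_normal (circle_point x) (circle_point y) =
        (2 * (p - q) / ?d) *\<^sub>R (1 + p * q, (1 - p * q, p + q))"
      using pos[of p] pos[of q] unfolding fin chord_normal_def
      by (simp add: divide_simps) (simp add: power2_eq_square algebra_simps)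
    have s: "1 / (2 * (p - q)\<^sup>2 / ?d) * (2 * (p - q) / ?d) = 1 / (p - q)"
    proof -
      have "1 / (2 * e\<^sup>2 / r) * (2 * e / r) = 1 / e" if "r > 0" "e \<noteq> 0" for e r :: real
        using that by (simp add: power2_eq_square)
      then show ?thesis using d fin(3) by (metis right_minus_eq)
    qed
    have "pole (circle_point x) (circle_point y) = (1 / (p - q)) *\<^sub>R (1 + p * q, (1 - p * q, p + q))"
      unfolding pole_def g c scaleR_scaleR s ..
    then show ?thesis
      by (simp add: i_def j_def k_def fin add_divide_distrib diff_divide_distrib)
  next
    case infl
    show ?thesis
      using pos[of q]
      by (simp add: i_def j_def k_def infl side_terms_at_infinity pole_def gap_def
          chord_normal_def inner_prod_def field_simps)
  next
    case infr
    have "i = 0" "j = -1" "k = - p"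
      unfolding i_def j_def k_def infr side_term.simps by (rule side_terms_at_infinity)+
    then show ?thesis
      using pos[of p]
      by (simp add: infr pole_def gap_def chord_normal_def inner_prod_def field_simps)
  qed
qed

lemma hyperbolic_barycenter_eq_pole_sum:
  fixes n :: nat and p :: "nat \<Rightarrow> rp1"
  defines "T \<equiv> \<Sum>l<n. pole (circle_point (p l)) (circle_point (p (Suc l mod n)))"
  assumes "\<And>l. l < n \<Longrightarrow> p l \<noteq> p (Suc l mod n)"
  shows "hyperbolic_barycenter n p = (1 / fst T) *\<^sub>R snd T"
proof -
  have "T = (I_sum n p + K_sum n p, (I_sum n p - K_sum n p, 2 * J_sum n p))"
    unfolding T_def I_sum_def J_sum_def K_sum_def
    by (simp add: pole_circle_points assms(2) prod_eq_iff fst_sum snd_sum sum.distrib sum_subtractf)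
  then show ?thesis
    by (simp add: hyperbolic_barycenter_def)
qed

section \<open>Regular polygons\<close>

text \<open>Multiplication by \<open>2 * sin (pi / n)\<close> turns the sum into a telescoping one.\<close>

lemma sum_cos_regular:
  assumes "n \<ge> 2"
  shows "(\<Sum>m<n. cos (2 * (pi / real n) * (x - real m))) = 0"
proof -
  define \<beta> where "\<beta> = pi / real n"
  define h where "h m = sin (\<beta> * (2 * (x - real m) + 1))" for m
  have "\<beta> > 0" "\<beta> < pi" using assms by (auto simp: \<beta>_def field_simps)
  then have s: "sin \<beta> \<noteq> 0" using sin_gt_zero by fastforce
  have "2 * sin \<beta> * cos (2 * \<beta> * (x - real m)) = h m - h (Suc m)" for m
  proof -
    have "h m = sin (2 * \<beta> * (x - real m) + \<beta>)" "h (Suc m) = sin (2 * \<beta> * (x - real m) - \<beta>)"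
      by (simp_all add: h_def algebra_simps)
    then show ?thesis by (simp add: sin_add sin_diff)
  qed
  then have "2 * sin \<beta> * (\<Sum>m<n. cos (2 * \<beta> * (x - real m))) = (\<Sum>m<n. h m - h (Suc m))"
    by (simp add: sum_distrib_left)
  also have "\<dots> = h 0 - h n" by (rule sum_lessThan_telescope')
  also have "h n = sin (\<beta> * (2 * x + 1) - 2 * pi)"
    using assms by (simp add: h_def \<beta>_def field_simps)
  also have "\<dots> = h 0" by (simp add: h_def sin_diff)
  finally show ?thesis using s by (simp add: \<beta>_def)
qed

lemma sin_times_sin_eq_diff_squares:
  fixes u b :: real
  shows "sin (u - b) * sin (u + b) = (sin u)\<^sup>2 - (sin b)\<^sup>2"
  by (simp add: sin_add sin_diff cos_squared_eq algebra_simps power2_eq_square[symmetric])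

text \<open>The value is \<open>n * cot\<^sup>2 \<beta>\<close>. What matters is that it does not depend on \<open>l\<close> and is positive: the product of
  two poles is an affine function of the cosine of the angle between their sides, and the cosines
  add up to zero.\<close>

lemma regular_mink_pole_sum:
  fixes \<theta> \<epsilon> :: real
  assumes n: "n \<ge> 3" and \<epsilon>: "\<epsilon> \<in> {1, -1}"
  defines "\<beta> \<equiv> pi / real n"
  defines "\<rho> \<equiv> \<lambda>l::nat. (cos (\<theta> + \<epsilon> * (2 * pi * real l / real n)),
                       sin (\<theta> + \<epsilon> * (2 * pi * real l / real n)))"
  shows "(\<Sum>m<n. mink (pole (\<rho> l) (\<rho> (Suc l))) (pole (\<rho> m) (\<rho> (Suc m))))
       = real n * (1 / (sin \<beta>)\<^sup>2 - 1)"
proof -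
  have "\<beta> > 0" "\<beta> < pi" using n by (auto simp: \<beta>_def field_simps)
  then have s: "sin \<beta> \<noteq> 0" using sin_gt_zero by fastforce
  have gap: "gap (\<rho> a) (\<rho> b) = 2 * (sin (\<beta> * (real a - real b)))\<^sup>2" for a b
  proof -
    have "\<rho> a \<bullet> \<rho> b = cos (\<epsilon> * (2 * (\<beta> * (real a - real b))))"
      unfolding \<rho>_def \<beta>_def inner_prod_def using cos_diff
      by (simp add: cos_diff[symmetric] algebra_simps diff_divide_distrib)
    also have "\<dots> = cos (2 * (\<beta> * (real a - real b)))" using \<epsilon> by auto
    finally show ?thesis by (simp add: gap_def cos_double_sin)
  qed
  have summand: "mink (pole (\<rho> l) (\<rho> (Suc l))) (pole (\<rho> m) (\<rho> (Suc m)))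
      = (1 - cos (2 * \<beta> * (real l - real m))) / (sin \<beta>)\<^sup>2 - 1" for m
  proof -
    define u where "u = \<beta> * (real l - real m)"
    have 1: "gap (\<rho> l) (\<rho> m) = 2 * (sin u)\<^sup>2" "gap (\<rho> (Suc l)) (\<rho> (Suc m)) = 2 * (sin u)\<^sup>2"
      by (simp_all add: gap u_def)
    have 2: "gap (\<rho> l) (\<rho> (Suc m)) = 2 * (sin (u - \<beta>))\<^sup>2"
      "gap (\<rho> (Suc l)) (\<rho> m) = 2 * (sin (u + \<beta>))\<^sup>2"
      by (simp_all add: gap u_def algebra_simps)
    have 3: "gap (\<rho> j) (\<rho> (Suc j)) = 2 * (sin \<beta>)\<^sup>2" for j
      by (simp add: gap algebra_simps)
    have 4: "(sin (u - \<beta>))\<^sup>2 * (sin (u + \<beta>))\<^sup>2 = ((sin u)\<^sup>2 - (sin \<beta>)\<^sup>2)\<^sup>2"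
      by (simp only: power_mult_distrib[symmetric] sin_times_sin_eq_diff_squares)
    have 5: "cos (2 * \<beta> * (real l - real m)) = 1 - 2 * (sin u)\<^sup>2"
      using cos_double_sin[of u] by (simp add: u_def mult.assoc)
    have cancel: "(2 * a * (2 * a) - 2 * b * (2 * c)) / (2 * e * (2 * e)) = (a\<^sup>2 - b * c) / e\<^sup>2"
      for a b c e :: real
      by (cases "e = 0") (simp_all add: field_simps power2_eq_square)
    have "mink (pole (\<rho> l) (\<rho> (Suc l))) (pole (\<rho> m) (\<rho> (Suc m)))
        = (((sin u)\<^sup>2)\<^sup>2 - (sin (u - \<beta>))\<^sup>2 * (sin (u + \<beta>))\<^sup>2) / ((sin \<beta>)\<^sup>2)\<^sup>2"
      unfolding mink_pole_pole 1 2 3 by (rule cancel)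
    also have "\<dots> = (1 - cos (2 * \<beta> * (real l - real m))) / (sin \<beta>)\<^sup>2 - 1"
      unfolding 4 5 using s by (simp add: field_simps power2_eq_square)
    finally show ?thesis .
  qed
  have "(\<Sum>m<n. 1 - cos (2 * \<beta> * (real l - real m))) = real n"
    using sum_cos_regular[of n "real l"] n by (simp add: sum_subtractf \<beta>_def)
  then show ?thesis
    by (simp add: summand sum_subtractf sum_divide_distrib[symmetric] algebra_simps)
qed

text \<open>The constant carries over from the regular polygon because both polygons have the same cross ratios
  of gaps.\<close>

lemma harmonic_mink_pole_sum:
  assumes n: "n \<ge> 3" and insc: "inscribed_polygon n p" and harm: "harmonic_polygon n p"
  defines "N \<equiv> \<lambda>l. pole (circle_point (p l)) (circle_point (p (Suc l mod n)))"
  obtains \<kappa> where "\<kappa> > 0" "\<And>l. l < n \<Longrightarrow> (\<Sum>m<n. mink (N l) (N m)) = \<kappa>"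
proof -
  obtain f R where f: "klein_isometry f" and R: "regular_polygon n R"
    and lim: "\<And>l. l < n \<Longrightarrow> (f \<longlongrightarrow> circle_point (p l)) (at (R l) within ball 0 1)"
    using harm by (auto simp: harmonic_polygon_def)
  obtain \<theta> \<epsilon> where \<epsilon>: "\<epsilon> \<in> {1, -1 :: real}" and R_eq:
    "\<And>l. l < n \<Longrightarrow> R l = (cos (\<theta> + \<epsilon> * (2 * pi * real l / real n)),
                       sin (\<theta> + \<epsilon> * (2 * pi * real l / real n)))"
    using R unfolding regular_polygon_def by blast
  define \<rho> where "\<rho> = (\<lambda>l::nat. (cos (\<theta> + \<epsilon> * (2 * pi * real l / real n)),
                       sin (\<theta> + \<epsilon> * (2 * pi * real l / real n))))"
  define P where "P l = circle_point (p l)" for l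
  define s where "s l = Suc l mod n" for l
  have s: "s l < n" "s l \<noteq> l" if "l < n" for l
    using n that by (auto simp: s_def mod_Suc)
  \<comment> \<open>\<open>\<rho>\<close> extends the regular polygon periodically to all indices, which absorbs the reduction modulo \<open>n\<close>.\<close>
  have \<rho>_s: "\<rho> (s l) = \<rho> (Suc l)" if "l < n" for l
  proof (cases "Suc l = n")
    case True
    have "\<theta> + \<epsilon> * (2 * pi * real n / real n) = \<theta> + \<epsilon> * (2 * pi)" using n by simp
    then show ?thesis
      using \<epsilon> True by (auto simp: s_def \<rho>_def cos_diff sin_diff)
  qed (use that in \<open>simp add: s_def\<close>)
  have unit: "norm (\<rho> l) = 1" for l by (simp add: \<rho>_def norm_Pair)
  have lim\<rho>: "(f \<longlongrightarrow> P l) (at (\<rho> l) within ball 0 1)" if "l < n" for l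
    using lim[OF that] R_eq[OF that] by (simp add: P_def \<rho>_def)
  have cross: "gap (P a) (P b) * gap (P c) (P d) * (gap (\<rho> a) (\<rho> c) * gap (\<rho> b) (\<rho> d))
       = gap (\<rho> a) (\<rho> b) * gap (\<rho> c) (\<rho> d) * (gap (P a) (P c) * gap (P b) (P d))"
    if "a < n" "b < n" "c < n" "d < n" for a b c d
    by (rule klein_isometry_gap_cross_ratio[OF f]) (use that unit lim\<rho> in auto)
  have P_pos: "gap (P l) (P (s l)) > 0" if "l < n" for l
  proof (rule gap_unit_pos)
    show "P l \<noteq> P (s l)"
      using insc that s[OF that]
      by (auto simp: P_def circle_point_eq_iff inscribed_polygon_def inj_on_def)
  qed (simp_all add: P_def)
  define \<beta> where "\<beta> = pi / real n"
  have \<beta>: "0 < \<beta>" "\<beta> < pi / 2" using n by (auto simp: \<beta>_def field_simps)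
  have sin_pos: "sin \<beta> > 0" using \<beta> by (intro sin_gt_zero) auto
  have \<rho>_pos: "gap (\<rho> l) (\<rho> (s l)) > 0" if "l < n" for l
  proof -
    have "\<rho> l \<bullet> \<rho> (Suc l) = cos (\<epsilon> * (2 * \<beta>))"
      unfolding \<rho>_def \<beta>_def inner_prod_def
      by (simp add: cos_diff[symmetric] algebra_simps add_divide_distrib)
    also have "\<dots> = cos (2 * \<beta>)" using \<epsilon> by auto
    finally show ?thesis
      using sin_pos by (simp add: \<rho>_s[OF that] gap_def cos_double_sin)
  qed
  have same: "mink (N l) (N m) = mink (pole (\<rho> l) (\<rho> (Suc l))) (pole (\<rho> m) (\<rho> (Suc m)))"
    if "l < n" "m < n" for l m
  proof -
    note lm = that s(1)[OF that(1)] s(1)[OF that(2)]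
    let ?w = "gap (P l) (P (s l)) * gap (P m) (P (s m))"
    let ?v = "gap (\<rho> l) (\<rho> (s l)) * gap (\<rho> m) (\<rho> (s m))"
    have pos: "?w > 0" "?v > 0" using P_pos \<rho>_pos that by simp_all
    have 1: "gap (P l) (P m) * gap (P (s l)) (P (s m)) * ?v
        = gap (\<rho> l) (\<rho> m) * gap (\<rho> (s l)) (\<rho> (s m)) * ?w"
      using cross[of l m "s l" "s m"] lm by simp
    have 2: "gap (P l) (P (s m)) * gap (P (s l)) (P m) * ?v
        = gap (\<rho> l) (\<rho> (s m)) * gap (\<rho> (s l)) (\<rho> m) * ?w"
      using cross[of l "s m" "s l" m] lm
      by (simp add: gap_commute[of "P (s m)" "P m"] gap_commute[of "\<rho> (s m)" "\<rho> m"])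
    have "(gap (P l) (P m) * gap (P (s l)) (P (s m)) - gap (P l) (P (s m)) * gap (P (s l)) (P m)) * ?v
        = (gap (\<rho> l) (\<rho> m) * gap (\<rho> (s l)) (\<rho> (s m)) - gap (\<rho> l) (\<rho> (s m)) * gap (\<rho> (s l)) (\<rho> m)) * ?w"
      unfolding left_diff_distrib 1 2 ..
    then have "mink (pole (P l) (P (s l))) (pole (P m) (P (s m)))
        = mink (pole (\<rho> l) (\<rho> (s l))) (pole (\<rho> m) (\<rho> (s m)))"
      unfolding mink_pole_pole using pos by (subst frac_eq_eq) auto
    then show ?thesis
      using that by (simp add: N_def P_def s_def[symmetric] \<rho>_s)
  qed
  show ?thesis
  proof
    have "cos \<beta> > 0" using \<beta> by (intro cos_gt_zero) auto
    then have "(sin \<beta>)\<^sup>2 < 1" by (simp add: sin_squared_eq)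
    then show "real n * (1 / (sin \<beta>)\<^sup>2 - 1) > 0" using n sin_pos by simp
    show "(\<Sum>m<n. mink (N l) (N m)) = real n * (1 / (sin \<beta>)\<^sup>2 - 1)" if "l < n" for l
      using regular_mink_pole_sum[OF n \<epsilon>, of \<theta> l] that by (simp add: same \<rho>_def \<beta>_def)
  qed
qed

section \<open>Least squares\<close>

text \<open>Hesse's normal form: the line is a level set of the inner product with a vector as long as \<open>B - A\<close>.\<close>

lemma infdist_line_squared:
  fixes A B X :: plane
  assumes "A \<noteq> B"
  shows "(infdist X (affine hull {A, B}))\<^sup>2
       = (mink (chord_normal A B) (1, X))\<^sup>2 / (norm (B - A))\<^sup>2"
proof -
  define d where "d = B - A"
  define e where "e = snd (chord_normal A B)"
  define c where "c = mink (chord_normal A B) (1, X)"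
  \<comment> \<open>The foot of the perpendicular from \<open>X\<close>.\<close>
  define F where "F = X + (c / (norm d)\<^sup>2) *\<^sub>R e"
  have d: "norm d > 0" using assms by (simp add: d_def)
  have norm_e: "norm e = norm d"
    by (simp add: e_def d_def chord_normal_def norm_prod_def power2_commute add.commute)
  have c: "c = e \<bullet> (A - X)"
    by (simp add: c_def e_def mink_def chord_normal_def inner_prod_def algebra_simps)
  have line: "affine hull {A, B} = {Y. e \<bullet> (A - Y) = 0}"
  proof (intro set_eqI iffI)
    fix Y assume "Y \<in> affine hull {A, B}"
    then obtain u v where "u + v = 1" "Y = u *\<^sub>R A + v *\<^sub>R B"
      by (auto simp: affine_hull_2)
    then have "u = 1 - v" "Y = u *\<^sub>R A + v *\<^sub>R B" by simp_all
    then have "A - Y = - v *\<^sub>R d"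
      by (simp add: d_def scaleR_diff_left scaleR_diff_right)
    moreover have "e \<bullet> d = 0"
      by (simp add: e_def d_def chord_normal_def inner_prod_def algebra_simps)
    ultimately show "Y \<in> {Y. e \<bullet> (A - Y) = 0}" by simp
  next
    fix Y assume "Y \<in> {Y. e \<bullet> (A - Y) = 0}"
    then have orth: "snd d * (fst Y - fst A) = fst d * (snd Y - snd A)"
      by (simp add: e_def d_def chord_normal_def inner_prod_def algebra_simps)
    define t where "t = (Y - A) \<bullet> d / (norm d)\<^sup>2"
    have "(norm d)\<^sup>2 = fst d * fst d + snd d * snd d"
      by (simp add: power2_norm_eq_inner inner_prod_def)
    moreover have "((Y - A) \<bullet> d) * fst d = (fst d * fst d + snd d * snd d) * (fst Y - fst A)"
      "((Y - A) \<bullet> d) * snd d = (fst d * fst d + snd d * snd d) * (snd Y - snd A)"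
      using orth by (simp_all add: inner_prod_def) algebra+
    ultimately have "t *\<^sub>R d = Y - A"
      using d by (simp add: t_def prod_eq_iff field_simps)
    then have "Y = (1 - t) *\<^sub>R A + t *\<^sub>R B"
      by (simp add: d_def algebra_simps)
    then show "Y \<in> affine hull {A, B}"
      unfolding affine_hull_2 by (intro CollectI exI[of _ "1 - t"] exI[of _ t]) simp
  qed
  have "e \<bullet> (A - F) = c - (c / (norm d)\<^sup>2) * (e \<bullet> e)"
    by (simp add: F_def c algebra_simps)
  also have "e \<bullet> e = (norm d)\<^sup>2"
    by (simp add: power2_norm_eq_inner[symmetric] norm_e)
  finally have F: "F \<in> affine hull {A, B}"
    using d by (simp add: line)
  have "dist X F = \<bar>c\<bar> / norm d"
    using d by (simp add: F_def dist_norm norm_e power2_eq_square)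
  moreover have "\<bar>c\<bar> / norm d \<le> dist X Y" if "Y \<in> affine hull {A, B}" for Y
  proof -
    have "c = e \<bullet> (Y - X)" using that by (simp add: line c inner_diff_right)
    then have "\<bar>c\<bar> \<le> norm d * dist X Y"
      using Cauchy_Schwarz_ineq2[of e "Y - X"] by (simp add: norm_e dist_norm norm_minus_commute)
    then show ?thesis using d by (simp add: field_simps)
  qed
  ultimately have "infdist X (affine hull {A, B}) = \<bar>c\<bar> / norm d"
    using F infdist_le[OF F, of X] by (intro antisym) (auto simp: infdist_def intro!: cINF_greatest)
  then show ?thesis
    by (simp add: c_def d_def power_divide)
qed

text \<open>Three points of a circle are not collinear. A chord is perpendicular to the sum of its endpoints, so if
  \<open>D \<noteq> 0\<close> were parallel to both \<open>AB\<close> and \<open>BC\<close>, it would be perpendicular to \<open>A + B\<close> and \<open>B + C\<close>, hence to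
  \<open>A - C\<close>; but it is also parallel to \<open>A - C\<close>.\<close>

lemma parallel_to_two_sides:
  fixes A B C D :: plane
  assumes unit: "norm A = 1" "norm B = 1" "norm C = 1" and ne: "A \<noteq> B" "B \<noteq> C" "A \<noteq> C"
    and par: "snd (chord_normal A B) \<bullet> D = 0" "snd (chord_normal B C) \<bullet> D = 0"
  shows "D = 0"
proof (rule ccontr)
  assume D: "D \<noteq> 0"
  have perp: "D \<bullet> (U + V) = 0"
    if "norm U = 1" "norm V = 1" "U \<noteq> V" "snd (chord_normal U V) \<bullet> D = 0" for U V :: plane
  proof -
    have cross: "(snd U - snd V) * fst D = (fst U - fst V) * snd D"
      using that(4) by (simp add: chord_normal_def inner_prod_def algebra_simps)
    have "U \<bullet> U = V \<bullet> V" using that(1,2) by (simp add: norm_eq_1)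
    then have "(U - V) \<bullet> (U + V) = 0" by (simp add: algebra_simps inner_commute)
    then have z: "(fst U - fst V) * (fst U + fst V) + (snd U - snd V) * (snd U + snd V) = 0"
      by (simp add: inner_prod_def)
    have "(fst U - fst V) * (D \<bullet> (U + V)) = 0" "(snd U - snd V) * (D \<bullet> (U + V)) = 0"
      using cross z unfolding inner_prod_def by (simp_all add: fst_add snd_add) algebra+
    then show ?thesis using that(3) by (auto simp: prod_eq_iff)
  qed
  have "D \<bullet> (A + B) = 0" "D \<bullet> (B + C) = 0"
    using perp unit ne par by blast+
  then have "D \<bullet> (A - C) = 0" by (simp add: algebra_simps)
  moreover have "(snd A - snd C) * fst D = (fst A - fst C) * snd D"
    using par by (simp add: chord_normal_def inner_prod_def algebra_simps)
  ultimately have "(fst D * fst D + snd D * snd D) * (fst A - fst C) = 0"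
    "(fst D * fst D + snd D * snd D) * (snd A - snd C) = 0"
    unfolding inner_prod_def fst_diff snd_diff inner_real_def by algebra+
  moreover have "fst D * fst D + snd D * snd D \<noteq> 0"
    using D by (simp add: prod_eq_iff sum_squares_eq_zero_iff)
  ultimately have "A = C" by (auto simp: prod_eq_iff)
  then show False using ne(3) by simp
qed

lemma sum_cyclic_shift:
  fixes g :: "nat \<Rightarrow> 'a::comm_monoid_add"
  assumes "n > 0"
  shows "(\<Sum>l<n. g (Suc l mod n)) = (\<Sum>l<n. g l)"
proof -
  obtain k where k: "n = Suc k" using assms by (cases n) auto
  have "(\<Sum>l<n. g (Suc l mod n)) = (\<Sum>l<k. g (Suc l)) + g 0"
    by (simp add: k)
  also have "\<dots> = (\<Sum>l<n. g l)"
    unfolding k sum.lessThan_Suc_shift by (simp add: add.commute)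
  finally show ?thesis .
qed

text \<open>The sides of a closed polygon, each turned by a right angle, add up to zero.\<close>

lemma sum_side_normals_eq_0:
  fixes P :: "nat \<Rightarrow> plane"
  assumes "n > 0"
  shows "(\<Sum>l<n. snd (chord_normal (P l) (P (Suc l mod n)))) = 0"
  using sum_cyclic_shift[OF assms, of "\<lambda>l. fst (P l)"] sum_cyclic_shift[OF assms, of "\<lambda>l. snd (P l)"]
  by (simp add: chord_normal_def prod_eq_iff fst_sum snd_sum sum_subtractf)

text \<open>The hypothesis says that the signed distances of \<open>S\<close> to the side lines are proportional to the
  side lengths, with the same factor for all sides. In the expansion of the sum of squares around
  \<open>S\<close> the linear term is then a multiple of the vanishing sum of the side normals, and a positive
  definite quadratic form \<open>E\<close> remains.\<close>

lemma least_squares_point_eqI: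
  fixes p :: "nat \<Rightarrow> rp1"
  assumes n: "n \<ge> 3" and insc: "inscribed_polygon n p"
    and const: "\<And>l. l < n \<Longrightarrow>
      mink (pole (circle_point (p l)) (circle_point (p (Suc l mod n)))) (1, S) = c"
  shows "least_squares_point n p = S"
proof -
  define P where "P l = circle_point (p l)" for l
  define v where "v l = chord_normal (P l) (P (Suc l mod n))" for l
  define w where "w l = gap (P l) (P (Suc l mod n))" for l
  have unit: "norm (P l) = 1" for l by (simp add: P_def)
  have P_ne: "P l \<noteq> P m" if "l < n" "m < n" "l \<noteq> m" for l m
    using insc that by (auto simp: P_def circle_point_eq_iff inscribed_polygon_def inj_on_def)
  have side_ne: "P l \<noteq> P (Suc l mod n)" if "l < n" for l
    using n that by (intro P_ne) (auto simp: mod_Suc)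
  have w: "w l > 0" if "l < n" for l
    unfolding w_def by (rule gap_unit_pos) (use unit side_ne[OF that] in auto)
  have vS: "mink (v l) (1, S) = c * w l" if "l < n" for l
    using const[OF that] w[OF that]
    by (simp add: pole_def v_def w_def P_def mink_def diff_divide_distrib[symmetric] divide_eq_eq)
  have dist: "(infdist X (side_line n p l))\<^sup>2 = (mink (v l) (1, X))\<^sup>2 / (2 * w l)" if "l < n" for X l
    using infdist_line_squared[OF side_ne[OF that], of X] gap_unit[OF unit unit]
    by (simp add: side_line_def P_def v_def w_def)
  define E where "E D = (\<Sum>l<n. (snd (v l) \<bullet> D)\<^sup>2 / (2 * w l))" for D
  have expand: "sum_sq_dist n p (S + D) = sum_sq_dist n p S + E D" for D
  proof -
    \<comment> \<open>The weight \<open>1 / (2 * w l)\<close> turns the coefficient \<open>c * w l\<close> of the linear term into a constant.\<close>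
    have "(mink (v l) (1, S + D))\<^sup>2 / (2 * w l) =
        (mink (v l) (1, S))\<^sup>2 / (2 * w l) - c * (snd (v l) \<bullet> D) + (snd (v l) \<bullet> D)\<^sup>2 / (2 * w l)"
      if "l < n" for l
    proof -
      have "mink (v l) (1, S + D) = c * w l - snd (v l) \<bullet> D"
        using vS[OF that] by (simp add: mink_def inner_add_right)
      then show ?thesis
        using w[OF that] by (simp only: vS[OF that]) (simp add: field_simps power2_eq_square)
    qed
    then have "sum_sq_dist n p (S + D) =
        sum_sq_dist n p S - c * ((\<Sum>l<n. snd (v l)) \<bullet> D) + E D"
      by (simp add: sum_sq_dist_def dist E_def sum.distrib sum_subtractf sum_distrib_left inner_sum_left)
    moreover have "(\<Sum>l<n. snd (v l)) = 0"
      using n by (simp add: v_def sum_side_normals_eq_0)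
    ultimately show ?thesis by simp
  qed
  have summand_nonneg: "(snd (v l) \<bullet> D)\<^sup>2 / (2 * w l) \<ge> 0" if "l \<in> {..<n}" for l D
    using w[of l] that by (simp add: less_imp_le)
  then have E_nonneg: "E D \<ge> 0" for D
    unfolding E_def by (rule sum_nonneg)
  have E_zero: "D = 0" if "E D \<le> 0" for D
  proof -
    have "E D = 0" using that E_nonneg[of D] by simp
    then have sum_0: "(\<Sum>l<n. (snd (v l) \<bullet> D)\<^sup>2 / (2 * w l)) = 0" unfolding E_def .
    have zero: "(snd (v l) \<bullet> D)\<^sup>2 / (2 * w l) = 0" if "l \<in> {..<n}" for l
      by (rule sum_nonneg_0[OF finite_lessThan summand_nonneg sum_0 that])
    have par: "snd (v l) \<bullet> D = 0" if "l < n" for l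
      using w[OF that] zero[of l] that by simp
    have "n > 0" "n > 1" "n > 2" using n by simp_all
    then have "P 0 \<noteq> P 1" "P 1 \<noteq> P 2" "P 0 \<noteq> P 2" by (simp_all add: P_ne)
    moreover have "snd (chord_normal (P 0) (P 1)) \<bullet> D = 0" "snd (chord_normal (P 1) (P 2)) \<bullet> D = 0"
      using par[of 0] par[of 1] n by (simp_all add: v_def numeral_2_eq_2)
    ultimately show "D = 0"
      using parallel_to_two_sides unit by blast
  qed
  show ?thesis
    unfolding least_squares_point_def
  proof (rule the_equality)
    show "\<forall>Y. sum_sq_dist n p S \<le> sum_sq_dist n p Y"
    proof
      fix Y
      show "sum_sq_dist n p S \<le> sum_sq_dist n p Y"
        using expand[of "Y - S"] E_nonneg[of "Y - S"] by simp
    qed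
  next
    fix X assume "\<forall>Y. sum_sq_dist n p X \<le> sum_sq_dist n p Y"
    then have "sum_sq_dist n p X \<le> sum_sq_dist n p S" ..
    then have "E (X - S) \<le> 0" using expand[of "X - S"] by simp
    then show "X = S" using E_zero[of "X - S"] by simp
  qed
qed

theorem theorem7p5:
  fixes n :: nat and p :: "nat \<Rightarrow> rp1"
  assumes "n \<ge> 3"
    and "inscribed_polygon n p"
    and "harmonic_polygon n p"
  shows "hyperbolic_barycenter n p = least_squares_point n p"
proof -
  define N where "N l = pole (circle_point (p l)) (circle_point (p (Suc l mod n)))" for l
  define T where "T = (\<Sum>l<n. N l)"
  obtain \<kappa> where \<kappa>: "\<kappa> > 0" "\<And>l. l < n \<Longrightarrow> (\<Sum>m<n. mink (N l) (N m)) = \<kappa>"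
    using harmonic_mink_pole_sum[OF assms] unfolding N_def by blast
  have NT: "mink (N l) T = \<kappa>" if "l < n" for l
    using \<kappa>(2)[OF that] by (simp add: T_def mink_sum_right)
  \<comment> \<open>\<open>T\<close> is timelike, so its time coordinate \<open>I + K\<close> does not vanish.\<close>
  have "mink T T = (\<Sum>l<n. mink (N l) T)"
    by (subst T_def) (rule mink_sum_left)
  also have "\<dots> = real n * \<kappa>" by (simp add: NT)
  finally have "mink T T > 0" using assms(1) \<kappa>(1) by simp
  then have T0: "fst T \<noteq> 0"
    using inner_ge_zero[of "snd T"] by (auto simp: mink_def simp del: inner_ge_zero)
  define S where "S = (1 / fst T) *\<^sub>R snd T"
  have "p l \<noteq> p (Suc l mod n)" if "l < n" for l
  proof -
    have "Suc l mod n < n" "Suc l mod n \<noteq> l" using assms(1) that by (auto simp: mod_Suc)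
    then show ?thesis using assms(2) that by (auto simp: inscribed_polygon_def inj_on_def)
  qed
  then have "hyperbolic_barycenter n p = S"
    using hyperbolic_barycenter_eq_pole_sum[of n p] by (simp add: S_def T_def N_def)
  moreover have "mink (N l) (1, S) = \<kappa> / fst T" if "l < n" for l
    using NT[OF that] T0 by (simp add: S_def mink_def field_simps)
  then have "least_squares_point n p = S"
    using least_squares_point_eqI[OF assms(1,2)] unfolding N_def by blast
  ultimately show ?thesis by simp
qed

end
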